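(* Let $\theta_i>0$, $i\leq I$, and for each $i\le I$ let $\psi_i:\mathcal X_i\times\mathcal Y_i\to\mathbb R$ be given by a $\mathcal K$-representation $$\psi_i(x^i,y^i)=\inf_{f_i,t_i,u_i}\{f_i^Ty^i+t_i: P_if_i+t_ip_i+Q_iu_i+R_ix^i\leq_{\mathbf K_i}s_i\}\quad\forall x^i\in\mathcal X_i,\ y^i\in\mathcal Y_i\qquad[\mathbf K_i\in\mathcal K].$$ Then for all $x=[x^1;\dots;x^I]\in\mathcal X=\mathcal X_1\times\dots\times\mathcal X_I$ and $y=[y^1;\dots;y^I]\in\mathcal Y=\mathcal Y_1\times\dots\times\mathcal Y_I$ the function $\psi(x,y):=\sum_i\theta_i\psi_i(x^i,y^i)$ satisfies $$\psi(x,y)=\inf_{f,t,\{f_i,t_i,u_i,\,i\leq I\}}\left\{f^Ty+t:\ \begin{array}{l} f=[\theta_1f_1;\dots;\theta_If_I],\ t=\sum_i\theta_it_i,\\ P_if_i+t_ip_i+Q_iu_i+R_ix^i\leq_{\mathbf K_i}s_i,\ 1\leq i\leq I\end{array}\right\},$$ which is a $\mathcal K$-representation of $\psi$ on $\mathcal X\times\mathcal Y$.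
   Context: $\mathcal K$ is a fixed family of regular cones (closed, convex, pointed, with nonempty interior) in Euclidean spaces which contains $\mathbb R_+$, is closed under finite direct products, and is closed under passing to dual cones. $a\leq_{\mathbf K}b$ means $b-a\in\mathbf K$. $[a;b]$ denotes vertical concatenation. Finite systems of $\mathcal K$-conic constraints, linear equalities and nonstrict linear inequalities are (equivalent to) a single $\mathcal K$-conic constraint. All sets $\mathcal X_i,\mathcal Y_i$ are nonempty, convex and $\mathcal K$-representable, i.e. of the form $\{x:\exists u:Ax+Bu\leq_{\mathbf K}c\}$ with $\mathbf K\in\mathcal K$. A $\mathcal K$-representation of a real-valued function $\psi$ on $\mathcal X\times\mathcal Y$ (convex in $x\in\mathcal X$, concave in $y\in\mathcal Y$, continuous) is an identity $\psi(x,y)=\inf_{f,t,u}\{f^Ty+t:Pf+tp+Qu+Rx\leq_{\mathbf K}s\}$ valid for all $x\in\mathcal X,y\in\mathcal Y$, with $\mathbf K\in\mathcal K$ (the constraint may be given as an equivalent finite system). *)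

theory Defs
  imports
    "HOL-Analysis.Function_Topology"
    "HOL-Analysis.Product_Topology"
    "HOL-Library.Extended_Real"
    "Jordan_Normal_Form.Matrix"
begin

text \<open>
  Dimensions vary inside the statement, so vectors of \<open>R\<^sup>n\<close> are elements of \<^term>\<open>carrier_vec n\<close>.
  The type of vectors carries no topology; \<open>R\<^sup>n\<close> gets the product topology of its coordinates.
\<close>

definition vec_topology :: "nat \<Rightarrow> real vec topology" where
  "vec_topology n =
     pullback_topology (carrier_vec n) (\<lambda>v. \<lambda>j\<in>{..<n}. vec_index v j) (powertop_real {..<n})"

definition vec_convex :: "real vec set \<Rightarrow> bool" where
  "vec_convex S \<longleftrightarrow>
     (\<forall>v\<in>S. \<forall>w\<in>S. \<forall>a. 0 \<le> a \<and> a \<le> 1 \<longrightarrow> (1 - a) \<cdot>\<^sub>v v + a \<cdot>\<^sub>v w \<in> S)"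

definition vec_convex_on :: "real vec set \<Rightarrow> (real vec \<Rightarrow> real) \<Rightarrow> bool" where
  "vec_convex_on S g \<longleftrightarrow>
     (\<forall>v\<in>S. \<forall>w\<in>S. \<forall>a. 0 \<le> a \<and> a \<le> 1 \<longrightarrow>
        g ((1 - a) \<cdot>\<^sub>v v + a \<cdot>\<^sub>v w) \<le> (1 - a) * g v + a * g w)"

subsection \<open>Families of regular cones\<close>

definition regular_cone :: "nat \<Rightarrow> real vec set \<Rightarrow> bool" where
  "regular_cone n C \<longleftrightarrow>
     C \<subseteq> carrier_vec n \<and>
     (\<forall>v\<in>C. \<forall>a\<ge>0. a \<cdot>\<^sub>v v \<in> C) \<and>
     vec_convex C \<and>
     closedin (vec_topology n) C \<and>
     (\<forall>v. v \<in> C \<and> - v \<in> C \<longrightarrow> v = 0\<^sub>v n) \<and>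
     vec_topology n interior_of C \<noteq> {}"

definition nonneg_ray :: "real vec set" where
  "nonneg_ray = {v \<in> carrier_vec 1. 0 \<le> vec_index v 0}"

definition cone_prod :: "real vec set \<Rightarrow> real vec set \<Rightarrow> real vec set" where
  "cone_prod C D = {v @\<^sub>v w | v w. v \<in> C \<and> w \<in> D}"

definition dual_cone :: "nat \<Rightarrow> real vec set \<Rightarrow> real vec set" where
  "dual_cone n C = {w \<in> carrier_vec n. \<forall>v\<in>C. 0 \<le> scalar_prod w v}"

text \<open>
  Concatenation is strictly associative, so closure under binary products is closure under all
  products of finitely many (at least one) members.
\<close>

definition cone_family :: "real vec set set \<Rightarrow> bool" where
  "cone_family \<K> \<longleftrightarrow>
     (\<forall>C\<in>\<K>. \<exists>n. regular_cone n C) \<and>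
     nonneg_ray \<in> \<K> \<and>
     (\<forall>C\<in>\<K>. \<forall>D\<in>\<K>. cone_prod C D \<in> \<K>) \<and>
     (\<forall>C\<in>\<K>. \<forall>n. C \<subseteq> carrier_vec n \<longrightarrow> dual_cone n C \<in> \<K>)"

definition cone_le :: "real vec set \<Rightarrow> real vec \<Rightarrow> real vec \<Rightarrow> bool" where
  "cone_le C a b \<longleftrightarrow> b - a \<in> C"

subsection \<open>\<open>\<K>\<close>-representations of sets and of convex-concave functions\<close>

definition K_representable_set :: "real vec set set \<Rightarrow> nat \<Rightarrow> real vec set \<Rightarrow> bool" where
  "K_representable_set \<K> n X \<longleftrightarrow>
     (\<exists>C\<in>\<K>. \<exists>r k A B c.
        C \<subseteq> carrier_vec r \<and> A \<in> carrier_mat r n \<and> B \<in> carrier_mat r k \<and> c \<in> carrier_vec r \<and>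
        X = {x \<in> carrier_vec n. \<exists>u\<in>carrier_vec k. cone_le C (A *\<^sub>v x + B *\<^sub>v u) c})"

definition K_domain :: "real vec set set \<Rightarrow> nat \<Rightarrow> real vec set \<Rightarrow> bool" where
  "K_domain \<K> n X \<longleftrightarrow> X \<noteq> {} \<and> vec_convex X \<and> K_representable_set \<K> n X"

definition convex_concave_continuous ::
    "nat \<Rightarrow> nat \<Rightarrow> real vec set \<Rightarrow> real vec set \<Rightarrow> (real vec \<Rightarrow> real vec \<Rightarrow> real) \<Rightarrow> bool" where
  "convex_concave_continuous n m X Y \<psi> \<longleftrightarrow>
     (\<forall>y\<in>Y. vec_convex_on X (\<lambda>x. \<psi> x y)) \<and>
     (\<forall>x\<in>X. vec_convex_on Y (\<lambda>y. - \<psi> x y)) \<and>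
     continuous_map (subtopology (prod_topology (vec_topology n) (vec_topology m)) (X \<times> Y))
       euclideanreal (\<lambda>(x, y). \<psi> x y)"

definition conic_constraint ::
    "real vec set \<Rightarrow> real mat \<Rightarrow> real vec \<Rightarrow> real mat \<Rightarrow> real mat \<Rightarrow> real vec \<Rightarrow>
     real vec \<Rightarrow> real \<Rightarrow> real vec \<Rightarrow> real vec \<Rightarrow> bool" where
  "conic_constraint C P p Q R s f t u x \<longleftrightarrow>
     cone_le C (P *\<^sub>v f + t \<cdot>\<^sub>v p + Q *\<^sub>v u + R *\<^sub>v x) s"

text \<open>
  The dimensions of \<open>x\<close>, \<open>y\<close>, \<open>u\<close> are \<open>n\<close>, \<open>m\<close>, \<open>q\<close>.  The infimum is taken in the extended reals, as
  the real \<^const>\<open>Inf\<close> is unspecified for empty or unbounded sets.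
\<close>

definition K_representation ::
    "real vec set set \<Rightarrow> nat \<Rightarrow> nat \<Rightarrow> nat \<Rightarrow> real vec set \<Rightarrow> real vec set \<Rightarrow>
     (real vec \<Rightarrow> real vec \<Rightarrow> real) \<Rightarrow>
     real vec set \<Rightarrow> real mat \<Rightarrow> real vec \<Rightarrow> real mat \<Rightarrow> real mat \<Rightarrow> real vec \<Rightarrow> bool" where
  "K_representation \<K> n m q X Y \<psi> C P p Q R s \<longleftrightarrow>
     K_domain \<K> n X \<and> K_domain \<K> m Y \<and>
     convex_concave_continuous n m X Y \<psi> \<and>
     C \<in> \<K> \<and>
     (\<exists>r. C \<subseteq> carrier_vec r \<and> P \<in> carrier_mat r m \<and> p \<in> carrier_vec r \<and>
          Q \<in> carrier_mat r q \<and> R \<in> carrier_mat r n \<and> s \<in> carrier_vec r) \<and>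
     (\<forall>x\<in>X. \<forall>y\<in>Y.
        ereal (\<psi> x y) =
          (INF (f, t, u) \<in> {(f, t, u). f \<in> carrier_vec m \<and> u \<in> carrier_vec q \<and>
                                     conic_constraint C P p Q R s f t u x}.
             ereal (scalar_prod f y + t)))"

subsection \<open>Block vectors\<close>

definition vec_concat :: "nat \<Rightarrow> (nat \<Rightarrow> 'a vec) \<Rightarrow> 'a vec" where
  "vec_concat N v = foldr (@\<^sub>v) (map v [0..<N]) vNil"

definition vec_block :: "(nat \<Rightarrow> nat) \<Rightarrow> nat \<Rightarrow> 'a vec \<Rightarrow> 'a vec" where
  "vec_block n i x = vec (n i) (\<lambda>j. vec_index x ((\<Sum>k<i. n k) + j))"

definition block_prod :: "nat \<Rightarrow> (nat \<Rightarrow> 'a vec set) \<Rightarrow> 'a vec set" where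
  "block_prod N X = {vec_concat N v | v. \<forall>i<N. v i \<in> X i}"

lemma vec_concat_0: "vec_concat 0 v = vNil"
  by (simp add: vec_concat_def)

lemma vec_concat_Suc: "vec_concat (Suc N) v = vec_concat N v @\<^sub>v v N"
proof -
  have *: "foldr (@\<^sub>v) us w = foldr (@\<^sub>v) us vNil @\<^sub>v w" for us :: "'a vec list" and w
    by (induction us) (auto simp: vec_eq_iff)
  show ?thesis
    unfolding vec_concat_def by (simp, subst *, auto simp: vec_eq_iff)
qed

lemma dim_vec_concat: "dim_vec (vec_concat N v) = (\<Sum>i<N. dim_vec (v i))"
  by (induction N) (auto simp: vec_concat_0 vec_concat_Suc)

lemma vec_block_concat:
  assumes "\<And>k. k < N \<Longrightarrow> v k \<in> carrier_vec (n k)" and "i < N"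
  shows "vec_block n i (vec_concat N v) = v i"
  using assms
proof (induction N)
  case (Suc N)
  have d: "dim_vec (vec_concat N v) = (\<Sum>k<N. n k)"
    unfolding dim_vec_concat using Suc.prems by (intro sum.cong) auto
  have e: "dim_vec (v k) = n k" if "k < Suc N" for k
    using Suc.prems(1)[OF that] by simp
  show ?case
  proof (cases "i = N")
    case True
    then show ?thesis
      using d e[of N] by (auto simp: vec_eq_iff vec_block_def vec_concat_Suc)
  next
    case False
    then have i: "i < N" using Suc.prems by simp
    have "(\<Sum>k<i. n k) + n i \<le> (\<Sum>k<N. n k)"
      using sum_mono2[of "{..<N}" "{..<Suc i}" n] i by auto
    then have "vec_block n i (vec_concat (Suc N) v) = vec_block n i (vec_concat N v)"
      using d e[of N] by (auto simp: vec_eq_iff vec_block_def vec_concat_Suc)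
    then show ?thesis using Suc i by simp
  qed
qed simp

subsection \<open>Weighted sums\<close>

definition weighted_sum ::
    "nat \<Rightarrow> (nat \<Rightarrow> real) \<Rightarrow> (nat \<Rightarrow> nat) \<Rightarrow> (nat \<Rightarrow> nat) \<Rightarrow>
     (nat \<Rightarrow> real vec \<Rightarrow> real vec \<Rightarrow> real) \<Rightarrow> real vec \<Rightarrow> real vec \<Rightarrow> real" where
  "weighted_sum N \<theta> n m \<psi> x y = (\<Sum>i<N. \<theta> i * \<psi> i (vec_block n i x) (vec_block m i y))"

definition sum_system ::
    "nat \<Rightarrow> (nat \<Rightarrow> real) \<Rightarrow>
     (nat \<Rightarrow> real vec set) \<Rightarrow> (nat \<Rightarrow> real mat) \<Rightarrow> (nat \<Rightarrow> real vec) \<Rightarrow> (nat \<Rightarrow> real mat) \<Rightarrow>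
     (nat \<Rightarrow> real mat) \<Rightarrow> (nat \<Rightarrow> real vec) \<Rightarrow>
     real vec \<Rightarrow> real \<Rightarrow> (nat \<Rightarrow> real vec) \<Rightarrow> (nat \<Rightarrow> real) \<Rightarrow> (nat \<Rightarrow> real vec) \<Rightarrow>
     (nat \<Rightarrow> real vec) \<Rightarrow> bool" where
  "sum_system N \<theta> C P p Q R s f t fs ts us xs \<longleftrightarrow>
     f = vec_concat N (\<lambda>i. \<theta> i \<cdot>\<^sub>v fs i) \<and>
     t = (\<Sum>i<N. \<theta> i * ts i) \<and>
     (\<forall>i<N. conic_constraint (C i) (P i) (p i) (Q i) (R i) (s i) (fs i) (ts i) (us i) (xs i))"

text \<open>The auxiliary variables of the system as one vector \<open>[f\<^sub>1; t\<^sub>1; u\<^sub>1; f\<^sub>2; t\<^sub>2; u\<^sub>2; \<dots>]\<close>.\<close>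

definition stack_aux ::
    "nat \<Rightarrow> (nat \<Rightarrow> real vec) \<Rightarrow> (nat \<Rightarrow> real) \<Rightarrow> (nat \<Rightarrow> real vec) \<Rightarrow> real vec" where
  "stack_aux N fs ts us = vec_concat N (\<lambda>i. fs i @\<^sub>v vCons (ts i) (us i))"

end

theory Submission
  imports Defs
begin

text \<open>
  The variables of the different summands are independent and the weights are nonnegative, so the
  infimum over the joint system is the weighted sum of the infima: one inequality holds termwise, and
  \<open>\<epsilon>\<close>-optimal choices in each summand give the converse.  That the joint system is a single conic
  constraint follows from a small calculus: predicates of \<open>(f, t, u, x)\<close> describable by one cone of \<open>\<K>\<close>
  are closed under conjunction (products of cones), contain linear equations (two copies of
  the ray \<open>R\<^sub>+\<close>) and are stable under substituting linear forms for the variables.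
\<close>

subsection \<open>Block vectors\<close>

text \<open>The definition of a representation asks for one cone and explicit matrices, while the
  number and the dimensions of the summands are arbitrary. Writing down the block matrices is
  avoided: a constraint is described only by saying that each coordinate of its left-hand side is a
  linear form in \<open>(f, t, u, x)\<close>, and the matrices are recovered afterwards from the
  coefficients of these forms. A single value \<open>t\<close> does not determine the individual
  t_i, so these have to become auxiliary variables. The f_i are kept as auxiliary variables too,
  which makes f = [\<theta>_1 f_1; ...] and t = \<Sum> \<theta>_i t_i linear equations between the
  visible and the auxiliary variables. Each summand thus contributes \<open>m i + 1 + q i\<close>
  auxiliary coordinates. The infimum of the single constraint is not computed again: stacking and
  unstacking the auxiliary variables shows that the system and the constraint give the same set of
  objective values.\<close>

lemma offset_less_sum:
  fixes n :: "nat \<Rightarrow> nat"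
  assumes "i < N" "j < n i"
  shows "(\<Sum>k<i. n k) + j < (\<Sum>k<N. n k)"
proof -
  have "(\<Sum>k<Suc i. n k) \<le> (\<Sum>k<N. n k)"
    using assms by (intro sum_mono2) auto
  then show ?thesis using assms by simp
qed

lemma vec_block_carrier [simp]: "vec_block n i x \<in> carrier_vec (n i)"
  by (simp add: vec_block_def)

lemma vec_block_lincomb:
  fixes x y :: "real vec"
  assumes "i < N" "x \<in> carrier_vec (\<Sum>k<N. n k)" "y \<in> carrier_vec (\<Sum>k<N. n k)"
  shows "vec_block n i (a \<cdot>\<^sub>v x + b \<cdot>\<^sub>v y) = a \<cdot>\<^sub>v vec_block n i x + b \<cdot>\<^sub>v vec_block n i y"
  using assms offset_less_sum[OF assms(1), of _ n] by (auto simp: vec_eq_iff vec_block_def)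

lemma vec_concat_cong: "(\<And>i. i < N \<Longrightarrow> v i = w i) \<Longrightarrow> vec_concat N v = vec_concat N w"
  by (induction N) (auto simp: vec_concat_0 vec_concat_Suc)

lemma vec_concat_carrier:
  assumes "\<And>i. i < N \<Longrightarrow> v i \<in> carrier_vec (n i)"
  shows "vec_concat N v \<in> carrier_vec (\<Sum>i<N. n i)"
proof (rule carrier_vecI)
  show "dim_vec (vec_concat N v) = (\<Sum>i<N. n i)"
    unfolding dim_vec_concat using assms by (intro sum.cong) auto
qed

lemma vec_concat_block:
  assumes "x \<in> carrier_vec (\<Sum>i<N. n i)"
  shows "vec_concat N (\<lambda>i. vec_block n i x) = x"
  using assms
proof (induction N arbitrary: x)
  case 0
  then show ?case by (auto simp: vec_concat_0 vec_eq_iff)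
next
  case (Suc N)
  \<comment> \<open>\<open>w\<close> is \<open>x\<close> with its last block cut off. The blocks
    before \<open>N\<close> read only entries of \<open>w\<close>, so the induction hypothesis
    rebuilds \<open>w\<close>, and block \<open>N\<close> supplies the remaining entries.\<close>
  define w where "w = vec (\<Sum>i<N. n i) (\<lambda>j. x $ j)"
  have "vec_block n i x = vec_block n i w" if "i < N" for i
    using offset_less_sum[OF that, of _ n] by (auto simp: vec_eq_iff vec_block_def w_def)
  then have "vec_concat N (\<lambda>i. vec_block n i x) = vec_concat N (\<lambda>i. vec_block n i w)"
    by (intro vec_concat_cong)
  also have "\<dots> = w" by (intro Suc.IH) (simp add: w_def)
  finally show ?case
    using Suc.prems by (auto simp: vec_concat_Suc vec_eq_iff w_def vec_block_def)
qed

text \<open>Used to replace the equation for \<open>f\<close> in the system by one equation per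
  block, a form that finite conjunctions of conic predicates can express.\<close>

lemma eq_vec_concat_iff:
  assumes "x \<in> carrier_vec (\<Sum>i<N. n i)" "\<And>i. i < N \<Longrightarrow> v i \<in> carrier_vec (n i)"
  shows "x = vec_concat N v \<longleftrightarrow> (\<forall>i<N. vec_block n i x = v i)"
  using vec_block_concat[of N v n] assms vec_concat_block[OF assms(1)]
    vec_concat_cong[of N "\<lambda>i. vec_block n i x" v] by auto

text \<open>The dimension condition on the right is essential: \<open>vec_block\<close> ignores
  entries past the last block, so all blocks of a vector that is too long can still lie in the
  factors.\<close>

lemma block_prod_iff:
  assumes "\<And>i. i < N \<Longrightarrow> X i \<subseteq> carrier_vec (n i)"
  shows "x \<in> block_prod N X \<longleftrightarrow>
           x \<in> carrier_vec (\<Sum>i<N. n i) \<and> (\<forall>i<N. vec_block n i x \<in> X i)"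
proof
  assume "x \<in> block_prod N X"
  then obtain v where "x = vec_concat N v" "\<forall>i<N. v i \<in> X i" by (auto simp: block_prod_def)
  moreover from this have "\<And>i. i < N \<Longrightarrow> v i \<in> carrier_vec (n i)" using assms by blast
  ultimately show "x \<in> carrier_vec (\<Sum>i<N. n i) \<and> (\<forall>i<N. vec_block n i x \<in> X i)"
    using vec_block_concat[of N v n] vec_concat_carrier[of N v n] by auto
next
  assume "x \<in> carrier_vec (\<Sum>i<N. n i) \<and> (\<forall>i<N. vec_block n i x \<in> X i)"
  then show "x \<in> block_prod N X"
    using vec_concat_block[of x n N] unfolding block_prod_def by force
qed

lemma scalar_prod_vec_concat:
  fixes v w :: "nat \<Rightarrow> real vec"
  assumes "\<And>i. i < N \<Longrightarrow> v i \<in> carrier_vec (n i)" "\<And>i. i < N \<Longrightarrow> w i \<in> carrier_vec (n i)"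
  shows "scalar_prod (vec_concat N v) (vec_concat N w) = (\<Sum>i<N. scalar_prod (v i) (w i))"
  using assms
proof (induction N)
  case 0
  then show ?case by (simp add: vec_concat_0 scalar_prod_def)
next
  case (Suc N)
  have "scalar_prod (vec_concat N v @\<^sub>v v N) (vec_concat N w @\<^sub>v w N) =
          scalar_prod (vec_concat N v) (vec_concat N w) + scalar_prod (v N) (w N)"
    using Suc.prems
    by (intro scalar_prod_append[where ?n1.0 = "\<Sum>i<N. n i"] vec_concat_carrier) auto
  then show ?case using Suc by (simp add: vec_concat_Suc)
qed

text \<open>\<open>aux_f\<close>, \<open>aux_t\<close> and \<open>aux_u\<close> undo
  \<open>stack_aux\<close>. Within block \<open>i\<close> of the stacked vector, positions below
  \<open>m i\<close> hold f_i, position \<open>m i\<close> holds t_i, and the following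
  \<open>q i\<close> positions hold u_i.\<close>

definition aux_f :: "(nat \<Rightarrow> nat) \<Rightarrow> (nat \<Rightarrow> nat) \<Rightarrow> nat \<Rightarrow> real vec \<Rightarrow> real vec" where
  "aux_f m q i u = vec (m i) (\<lambda>j. vec_block (\<lambda>i. m i + Suc (q i)) i u $ j)"

definition aux_t :: "(nat \<Rightarrow> nat) \<Rightarrow> (nat \<Rightarrow> nat) \<Rightarrow> nat \<Rightarrow> real vec \<Rightarrow> real" where
  "aux_t m q i u = vec_block (\<lambda>i. m i + Suc (q i)) i u $ m i"

definition aux_u :: "(nat \<Rightarrow> nat) \<Rightarrow> (nat \<Rightarrow> nat) \<Rightarrow> nat \<Rightarrow> real vec \<Rightarrow> real vec" where
  "aux_u m q i u = vec (q i) (\<lambda>j. vec_block (\<lambda>i. m i + Suc (q i)) i u $ (m i + Suc j))"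

lemma aux_carrier [simp]:
  "aux_f m q i u \<in> carrier_vec (m i)" "aux_u m q i u \<in> carrier_vec (q i)"
  by (simp_all add: aux_f_def aux_u_def)

lemma
  assumes "\<And>i. i < N \<Longrightarrow> fs i \<in> carrier_vec (m i)" "\<And>i. i < N \<Longrightarrow> us i \<in> carrier_vec (q i)"
  shows stack_aux_carrier: "stack_aux N fs ts us \<in> carrier_vec (\<Sum>i<N. m i + Suc (q i))"
    and aux_f_stack_aux: "i < N \<Longrightarrow> aux_f m q i (stack_aux N fs ts us) = fs i"
    and aux_t_stack_aux: "i < N \<Longrightarrow> aux_t m q i (stack_aux N fs ts us) = ts i"
    and aux_u_stack_aux: "i < N \<Longrightarrow> aux_u m q i (stack_aux N fs ts us) = us i"
proof -
  have c: "fs i @\<^sub>v vCons (ts i) (us i) \<in> carrier_vec (m i + Suc (q i))" if "i < N" for i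
    using assms[OF that] by (intro append_carrier_vec) auto
  show "stack_aux N fs ts us \<in> carrier_vec (\<Sum>i<N. m i + Suc (q i))"
    unfolding stack_aux_def by (rule vec_concat_carrier[OF c])
  assume i: "i < N"
  have b: "vec_block (\<lambda>i. m i + Suc (q i)) i (stack_aux N fs ts us) = fs i @\<^sub>v vCons (ts i) (us i)"
    unfolding stack_aux_def
    using vec_block_concat[where n = "\<lambda>i. m i + Suc (q i)", OF c i] .
  have d: "dim_vec (fs i) = m i" "dim_vec (us i) = q i"
    using assms[OF i] by auto
  show "aux_f m q i (stack_aux N fs ts us) = fs i"
    unfolding aux_f_def b using d by (auto simp: vec_eq_iff)
  show "aux_t m q i (stack_aux N fs ts us) = ts i"
    unfolding aux_t_def b using d by simp
  show "aux_u m q i (stack_aux N fs ts us) = us i"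
    unfolding aux_u_def b using d by (auto simp: vec_eq_iff)
qed

text \<open>The converse of the preceding inversion: no auxiliary vector of the right dimension is
  missed by stacking, so every feasible point of the single constraint comes from a feasible point
  of the system.\<close>

lemma stack_aux_aux:
  assumes "u \<in> carrier_vec (\<Sum>i<N. m i + Suc (q i))"
  shows "stack_aux N (\<lambda>i. aux_f m q i u) (\<lambda>i. aux_t m q i u) (\<lambda>i. aux_u m q i u) = u"
proof -
  have "aux_f m q i u @\<^sub>v vCons (aux_t m q i u) (aux_u m q i u) =
          vec_block (\<lambda>i. m i + Suc (q i)) i u" (is "?l = ?b") for i
  proof (rule eq_vecI)
    show "dim_vec ?l = dim_vec ?b"
      by (simp add: aux_f_def aux_u_def vec_block_def)
    fix j assume "j < dim_vec ?b"
    then have "j < m i + Suc (q i)" by (simp add: vec_block_def)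
    then consider "j < m i" | "j = m i" | k where "j = m i + Suc k" "k < q i"
      by (metis add_Suc_right add_less_cancel_left less_SucE less_imp_Suc_add linorder_neqE_nat
          nat_add_left_cancel_less not_less_eq)
    then show "?l $ j = ?b $ j"
      by cases (simp_all add: aux_f_def aux_t_def aux_u_def)
  qed
  then show ?thesis
    unfolding stack_aux_def using vec_concat_block[OF assms] by simp
qed

text \<open>Families are functions on all naturals, but unstacking recovers them only at indices
  below \<open>N\<close>. They need not agree as functions, so rewriting inside the system requires
  this congruence.\<close>

lemma sum_system_cong:
  assumes "\<And>i. i < N \<Longrightarrow> fs i = fs' i" "\<And>i. i < N \<Longrightarrow> ts i = ts' i"
    "\<And>i. i < N \<Longrightarrow> us i = us' i" "\<And>i. i < N \<Longrightarrow> xs i = xs' i"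
  shows "sum_system N \<theta> C P p Q R s f t fs ts us xs \<longleftrightarrow>
         sum_system N \<theta> C P p Q R s f t fs' ts' us' xs'"
proof -
  have "vec_concat N (\<lambda>i. \<theta> i \<cdot>\<^sub>v fs i) = vec_concat N (\<lambda>i. \<theta> i \<cdot>\<^sub>v fs' i)"
    using assms by (intro vec_concat_cong) simp
  then show ?thesis using assms by (simp add: sum_system_def)
qed

subsection \<open>Conic systems\<close>

text \<open>There is no constant term, because constants belong to the right-hand side
  \<open>s\<close> of a conic constraint. The identity is demanded only for arguments of the proper
  dimensions, where the scalar products are meaningful.\<close>

definition linear_form ::
    "nat \<Rightarrow> nat \<Rightarrow> nat \<Rightarrow> (real vec \<Rightarrow> real \<Rightarrow> real vec \<Rightarrow> real vec \<Rightarrow> real) \<Rightarrow> bool" where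
  "linear_form m q n \<phi> \<longleftrightarrow>
     (\<exists>a\<in>carrier_vec m. \<exists>b. \<exists>c\<in>carrier_vec q. \<exists>d\<in>carrier_vec n.
        \<forall>f\<in>carrier_vec m. \<forall>t. \<forall>u\<in>carrier_vec q. \<forall>x\<in>carrier_vec n.
          \<phi> f t u x = scalar_prod a f + b * t + scalar_prod c u + scalar_prod d x)"

lemma linear_formI:
  assumes "a \<in> carrier_vec m" "c \<in> carrier_vec q" "d \<in> carrier_vec n"
    "\<And>f t u x. f \<in> carrier_vec m \<Longrightarrow> u \<in> carrier_vec q \<Longrightarrow> x \<in> carrier_vec n \<Longrightarrow>
       \<phi> f t u x = scalar_prod a f + b * t + scalar_prod c u + scalar_prod d x"
  shows "linear_form m q n \<phi>"
  using assms unfolding linear_form_def by blast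

lemma linear_form_0: "linear_form m q n (\<lambda>f t u x. 0)"
  by (rule linear_formI[where a = "0\<^sub>v m" and b = 0 and c = "0\<^sub>v q" and d = "0\<^sub>v n"]) auto

lemma linear_form_t: "linear_form m q n (\<lambda>f t u x. t)"
  by (rule linear_formI[where a = "0\<^sub>v m" and b = 1 and c = "0\<^sub>v q" and d = "0\<^sub>v n"]) auto

lemma linear_form_index_f: "j < m \<Longrightarrow> linear_form m q n (\<lambda>f t u x. f $ j)"
  by (rule linear_formI[where a = "unit_vec m j" and b = 0 and c = "0\<^sub>v q" and d = "0\<^sub>v n"]) auto

lemma linear_form_index_u: "j < q \<Longrightarrow> linear_form m q n (\<lambda>f t u x. u $ j)"
  by (rule linear_formI[where a = "0\<^sub>v m" and b = 0 and c = "unit_vec q j" and d = "0\<^sub>v n"]) auto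

lemma linear_form_index_x: "j < n \<Longrightarrow> linear_form m q n (\<lambda>f t u x. x $ j)"
  by (rule linear_formI[where a = "0\<^sub>v m" and b = 0 and c = "0\<^sub>v q" and d = "unit_vec n j"]) auto

lemma linear_form_add:
  assumes "linear_form m q n \<phi>" "linear_form m q n \<phi>'"
  shows "linear_form m q n (\<lambda>f t u x. \<phi> f t u x + \<phi>' f t u x)"
proof -
  obtain a b c d where 1: "a \<in> carrier_vec m" "c \<in> carrier_vec q" "d \<in> carrier_vec n"
    "\<forall>f\<in>carrier_vec m. \<forall>t. \<forall>u\<in>carrier_vec q. \<forall>x\<in>carrier_vec n.
       \<phi> f t u x = scalar_prod a f + b * t + scalar_prod c u + scalar_prod d x"
    using assms(1) unfolding linear_form_def by blast
  obtain a' b' c' d' where 2: "a' \<in> carrier_vec m" "c' \<in> carrier_vec q" "d' \<in> carrier_vec n"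
    "\<forall>f\<in>carrier_vec m. \<forall>t. \<forall>u\<in>carrier_vec q. \<forall>x\<in>carrier_vec n.
       \<phi>' f t u x = scalar_prod a' f + b' * t + scalar_prod c' u + scalar_prod d' x"
    using assms(2) unfolding linear_form_def by blast
  show ?thesis
    using 1 2
    by (intro linear_formI[where a = "a + a'" and b = "b + b'" and c = "c + c'" and d = "d + d'"])
      (auto simp: add_scalar_prod_distrib algebra_simps)
qed

lemma linear_form_mult:
  assumes "linear_form m q n \<phi>"
  shows "linear_form m q n (\<lambda>f t u x. k * \<phi> f t u x)"
proof -
  obtain a b c d where 1: "a \<in> carrier_vec m" "c \<in> carrier_vec q" "d \<in> carrier_vec n"
    "\<forall>f\<in>carrier_vec m. \<forall>t. \<forall>u\<in>carrier_vec q. \<forall>x\<in>carrier_vec n.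
       \<phi> f t u x = scalar_prod a f + b * t + scalar_prod c u + scalar_prod d x"
    using assms(1) unfolding linear_form_def by blast
  show ?thesis
    using 1
    by (intro linear_formI[where a = "k \<cdot>\<^sub>v a" and b = "k * b" and c = "k \<cdot>\<^sub>v c" and d = "k \<cdot>\<^sub>v d"])
      (auto simp: algebra_simps)
qed

lemma linear_form_diff:
  assumes "linear_form m q n \<phi>" "linear_form m q n \<phi>'"
  shows "linear_form m q n (\<lambda>f t u x. \<phi> f t u x - \<phi>' f t u x)"
  using linear_form_add[OF assms(1) linear_form_mult[OF assms(2), of "-1"]] by simp

lemma linear_form_sum:
  assumes "\<And>i. i < (k::nat) \<Longrightarrow> linear_form m q n (\<phi> i)"
  shows "linear_form m q n (\<lambda>f t u x. \<Sum>i<k. \<phi> i f t u x)"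
  using assms by (induction k) (simp_all add: linear_form_0 linear_form_add)

lemma linear_form_mult_mat_vec:
  assumes "A \<in> carrier_mat r k" "l < r" "\<And>f t u x. h f t u x \<in> carrier_vec k"
    "\<And>j. j < k \<Longrightarrow> linear_form m q n (\<lambda>f t u x. h f t u x $ j)"
  shows "linear_form m q n (\<lambda>f t u x. (A *\<^sub>v h f t u x) $ l)"
proof -
  \<comment> \<open>Since \<open>h\<close> has dimension \<open>k\<close> for all arguments, without
    carrier conditions, this equation holds unconditionally and can be rewritten under the binders
    of the form.\<close>
  have "(A *\<^sub>v h f t u x) $ l = (\<Sum>j<k. A $$ (l, j) * h f t u x $ j)" for f t u x
    using assms(1,2) assms(3)[of f t u x]
    by (auto simp: scalar_prod_def lessThan_atLeast0 intro!: sum.cong)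
  then show ?thesis
    by (simp add: linear_form_sum linear_form_mult assms(4))
qed

section \<open>Predicates described by a single cone of the family\<close>

lemma conic_lhs_carrier:
  "R \<in> carrier_mat r n \<Longrightarrow> P *\<^sub>v f + t \<cdot>\<^sub>v p + Q *\<^sub>v u + R *\<^sub>v x \<in> carrier_vec r"
  by (rule carrier_vecI) simp

text \<open>The data and dimension conditions are those of \<open>K_representation\<close>. A
  predicate with this property therefore supplies everything algebraic in a representation; what
  remains is analysis of the domains, the function and the infimum.\<close>

definition K_conic ::
    "real vec set set \<Rightarrow> nat \<Rightarrow> nat \<Rightarrow> nat \<Rightarrow>
     (real vec \<Rightarrow> real \<Rightarrow> real vec \<Rightarrow> real vec \<Rightarrow> bool) \<Rightarrow> bool" where
  "K_conic \<K> m q n \<Phi> \<longleftrightarrow>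
     (\<exists>C\<in>\<K>. \<exists>r P p Q R s.
        C \<subseteq> carrier_vec r \<and> P \<in> carrier_mat r m \<and> p \<in> carrier_vec r \<and>
        Q \<in> carrier_mat r q \<and> R \<in> carrier_mat r n \<and> s \<in> carrier_vec r \<and>
        (\<forall>f\<in>carrier_vec m. \<forall>t. \<forall>u\<in>carrier_vec q. \<forall>x\<in>carrier_vec n.
           \<Phi> f t u x \<longleftrightarrow> conic_constraint C P p Q R s f t u x))"

text \<open>The coefficient vectors of the \<open>l\<close>-th coordinate form become the
  \<open>l\<close>-th rows of the three matrices, and its coefficient of \<open>t\<close> the
  \<open>l\<close>-th entry of the vector \<open>p\<close>.\<close>

lemma K_conicI:
  assumes "C \<in> \<K>" "C \<subseteq> carrier_vec r" "s \<in> carrier_vec r"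
    "\<And>f t u x. f \<in> carrier_vec m \<Longrightarrow> u \<in> carrier_vec q \<Longrightarrow> x \<in> carrier_vec n \<Longrightarrow>
       g f t u x \<in> carrier_vec r"
    "\<And>l. l < r \<Longrightarrow> linear_form m q n (\<lambda>f t u x. g f t u x $ l)"
    "\<And>f t u x. f \<in> carrier_vec m \<Longrightarrow> u \<in> carrier_vec q \<Longrightarrow> x \<in> carrier_vec n \<Longrightarrow>
       \<Phi> f t u x \<longleftrightarrow> cone_le C (g f t u x) s"
  shows "K_conic \<K> m q n \<Phi>"
proof -
  \<comment> \<open>The guard \<open>l < r\<close> stands under the existential quantifiers, so that
    the choice principle yields total functions of \<open>l\<close>; the values at other
    \<open>l\<close> are arbitrary.\<close>
  have "\<forall>l. \<exists>a b c d. l < r \<longrightarrow> a \<in> carrier_vec m \<and> c \<in> carrier_vec q \<and> d \<in> carrier_vec n \<and>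
      (\<forall>f\<in>carrier_vec m. \<forall>t. \<forall>u\<in>carrier_vec q. \<forall>x\<in>carrier_vec n.
        g f t u x $ l = scalar_prod a f + b * t + scalar_prod c u + scalar_prod d x)"
    using assms(5) unfolding linear_form_def by meson
  then obtain a b c d where g: "\<And>l. l < r \<Longrightarrow> a l \<in> carrier_vec m \<and> c l \<in> carrier_vec q \<and>
      d l \<in> carrier_vec n \<and>
      (\<forall>f\<in>carrier_vec m. \<forall>t. \<forall>u\<in>carrier_vec q. \<forall>x\<in>carrier_vec n.
        g f t u x $ l = scalar_prod (a l) f + b l * t + scalar_prod (c l) u + scalar_prod (d l) x)"
    unfolding choice_iff by blast
  define M where "M k v = mat r k (\<lambda>(l, j). v l $ j)" for k and v :: "nat \<Rightarrow> real vec"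
  have M: "row (M k v) l = v l" if "l < r" "v l \<in> carrier_vec k" for k v l
    using that by (auto simp: M_def vec_eq_iff)
  have "M m a *\<^sub>v f + t \<cdot>\<^sub>v vec r b + M q c *\<^sub>v u + M n d *\<^sub>v x = g f t u x"
    if "f \<in> carrier_vec m" "u \<in> carrier_vec q" "x \<in> carrier_vec n" for f t u x
  proof (rule eq_vecI)
    show "dim_vec (M m a *\<^sub>v f + t \<cdot>\<^sub>v vec r b + M q c *\<^sub>v u + M n d *\<^sub>v x) = dim_vec (g f t u x)"
      using assms(4)[OF that, of t] by (simp add: M_def)
    fix l assume "l < dim_vec (g f t u x)"
    then have l: "l < r" using assms(4)[OF that, of t] by simp
    have d: "dim_row (M k v) = r" for k v by (simp add: M_def)
    show "(M m a *\<^sub>v f + t \<cdot>\<^sub>v vec r b + M q c *\<^sub>v u + M n d *\<^sub>v x) $ l = g f t u x $ l"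
      using g[OF l] that l by (simp add: d M)
  qed
  then have "\<forall>f\<in>carrier_vec m. \<forall>t. \<forall>u\<in>carrier_vec q. \<forall>x\<in>carrier_vec n.
      \<Phi> f t u x \<longleftrightarrow> conic_constraint C (M m a) (vec r b) (M q c) (M n d) s f t u x"
    using assms(6) by (simp add: conic_constraint_def)
  moreover have "M k v \<in> carrier_mat r k" for k v by (simp add: M_def)
  ultimately show ?thesis
    unfolding K_conic_def using assms(1-3) by (meson vec_carrier)
qed

lemma K_conic_cong:
  assumes "K_conic \<K> m q n \<Phi>"
    "\<And>f t u x. f \<in> carrier_vec m \<Longrightarrow> u \<in> carrier_vec q \<Longrightarrow> x \<in> carrier_vec n \<Longrightarrow>
       \<Phi>' f t u x \<longleftrightarrow> \<Phi> f t u x"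
  shows "K_conic \<K> m q n \<Phi>'"
  using assms unfolding K_conic_def by simp

text \<open>\<open>cone_le\<close> places right-hand side minus left-hand side in the cone. With
  right-hand side 0 the left-hand side must be the negated form.\<close>

lemma K_conic_nonneg:
  assumes "cone_family \<K>" "linear_form m q n \<phi>"
  shows "K_conic \<K> m q n (\<lambda>f t u x. 0 \<le> \<phi> f t u x)"
proof (rule K_conicI[where C = nonneg_ray and r = 1 and s = "0\<^sub>v 1"
      and g = "\<lambda>f t u x. vec 1 (\<lambda>_. - \<phi> f t u x)"])
  show "nonneg_ray \<in> \<K>" using assms(1) by (simp add: cone_family_def)
  show "linear_form m q n (\<lambda>f t u x. vec 1 (\<lambda>_. - \<phi> f t u x) $ l)" if "l < 1" for l
    using linear_form_mult[OF assms(2), of "-1"] that by simp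
qed (auto simp: nonneg_ray_def cone_le_def)

text \<open>A concatenation splits in only one way once the length of its first part is known, and
  all members of \<open>C\<close> have length \<open>r\<close>.\<close>

lemma append_in_cone_prod_iff:
  assumes "C \<subseteq> carrier_vec r" "v \<in> carrier_vec r"
  shows "v @\<^sub>v w \<in> cone_prod C D \<longleftrightarrow> v \<in> C \<and> w \<in> D"
proof
  assume "v @\<^sub>v w \<in> cone_prod C D"
  then obtain v' w' where "v @\<^sub>v w = v' @\<^sub>v w'" and in_CD: "v' \<in> C" "w' \<in> D"
    by (auto simp: cone_prod_def)
  then have "v = v' \<and> w = w'" using append_vec_eq[OF assms(2), of v' w w'] assms(1) by auto
  then show "v \<in> C \<and> w \<in> D" using in_CD by simp
qed (auto simp: cone_prod_def)

text \<open>Both sides of the two constraints are concatenated. The difference of the concatenations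
  is the concatenation of the differences, and it lies in the product cone exactly when each part
  lies in its own cone.\<close>

lemma K_conic_conj:
  assumes "cone_family \<K>" "K_conic \<K> m q n \<Phi>" "K_conic \<K> m q n \<Psi>"
  shows "K_conic \<K> m q n (\<lambda>f t u x. \<Phi> f t u x \<and> \<Psi> f t u x)"
proof -
  obtain C r P p Q R s where 1: "C \<in> \<K>" "C \<subseteq> carrier_vec r" "P \<in> carrier_mat r m"
    "p \<in> carrier_vec r" "Q \<in> carrier_mat r q" "R \<in> carrier_mat r n" "s \<in> carrier_vec r"
    "\<forall>f\<in>carrier_vec m. \<forall>t. \<forall>u\<in>carrier_vec q. \<forall>x\<in>carrier_vec n.
       \<Phi> f t u x \<longleftrightarrow> conic_constraint C P p Q R s f t u x"
    using assms(2) unfolding K_conic_def by blast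
  obtain C' r' P' p' Q' R' s' where 2: "C' \<in> \<K>" "C' \<subseteq> carrier_vec r'" "P' \<in> carrier_mat r' m"
    "p' \<in> carrier_vec r'" "Q' \<in> carrier_mat r' q" "R' \<in> carrier_mat r' n" "s' \<in> carrier_vec r'"
    "\<forall>f\<in>carrier_vec m. \<forall>t. \<forall>u\<in>carrier_vec q. \<forall>x\<in>carrier_vec n.
       \<Psi> f t u x \<longleftrightarrow> conic_constraint C' P' p' Q' R' s' f t u x"
    using assms(3) unfolding K_conic_def by blast
  define g where "g f t u x = P *\<^sub>v f + t \<cdot>\<^sub>v p + Q *\<^sub>v u + R *\<^sub>v x" for f t u x
  define g' where "g' f t u x = P' *\<^sub>v f + t \<cdot>\<^sub>v p' + Q' *\<^sub>v u + R' *\<^sub>v x" for f t u x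
  have g: "g f t u x \<in> carrier_vec r" for f t u x
    using 1(6) by (simp add: g_def conic_lhs_carrier)
  have g': "g' f t u x \<in> carrier_vec r'" for f t u x
    using 2(6) by (simp add: g'_def conic_lhs_carrier)
  have lin: "linear_form m q n (\<lambda>f t u x. g f t u x $ l)" if "l < r" for l
    using 1(3-6) that
    by (intro linear_formI[where a = "row P l" and b = "p $ l" and c = "row Q l" and d = "row R l"])
      (auto simp: g_def)
  have lin': "linear_form m q n (\<lambda>f t u x. g' f t u x $ l)" if "l < r'" for l
    using 2(3-6) that
    by (intro linear_formI[where a = "row P' l" and b = "p' $ l" and c = "row Q' l" and d = "row R' l"])
      (auto simp: g'_def)
  show ?thesis
  proof (rule K_conicI[where C = "cone_prod C C'" and r = "r + r'" and s = "s @\<^sub>v s'"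
        and g = "\<lambda>f t u x. g f t u x @\<^sub>v g' f t u x"])
    show "cone_prod C C' \<in> \<K>" using assms(1) 1(1) 2(1) by (simp add: cone_family_def)
    show "cone_prod C C' \<subseteq> carrier_vec (r + r')" using 1(2) 2(2) by (auto simp: cone_prod_def)
    show "linear_form m q n (\<lambda>f t u x. (g f t u x @\<^sub>v g' f t u x) $ l)" if "l < r + r'" for l
    proof -
      have "dim_vec (g f t u x) = r" "dim_vec (g' f t u x) = r'" for f t u x
        using g[of f t u x] g'[of f t u x] by auto
      \<comment> \<open>The case distinction can be moved outside the abstraction because the
        dimension of \<open>g f t u x\<close> is \<open>r\<close> for all arguments.\<close>
      then have "(\<lambda>f t u x. (g f t u x @\<^sub>v g' f t u x) $ l) =
          (if l < r then (\<lambda>f t u x. g f t u x $ l) else (\<lambda>f t u x. g' f t u x $ (l - r)))"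
        using that by (auto simp: fun_eq_iff)
      then show ?thesis using lin lin' that by simp
    qed
    fix f u x :: "real vec" and t :: real
    assume fux: "f \<in> carrier_vec m" "u \<in> carrier_vec q" "x \<in> carrier_vec n"
    show "(\<Phi> f t u x \<and> \<Psi> f t u x) \<longleftrightarrow> cone_le (cone_prod C C') (g f t u x @\<^sub>v g' f t u x) (s @\<^sub>v s')"
    proof -
      have e: "(s @\<^sub>v s') - (g f t u x @\<^sub>v g' f t u x) = (s - g f t u x) @\<^sub>v (s' - g' f t u x)"
        using g[of f t u x] g'[of f t u x] 1(7) 2(7) by (auto simp: vec_eq_iff)
      have "s - g f t u x \<in> carrier_vec r" using g[of f t u x] 1(7) by simp
      then show ?thesis
        using 1(8) 2(8) fux unfolding conic_constraint_def cone_le_def e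
        by (simp add: append_in_cone_prod_iff[OF 1(2)] g_def g'_def)
    qed
  qed (use g g' 1(7) 2(7) in auto)
qed

lemma K_conic_all:
  assumes "cone_family \<K>" "\<And>i. i < k \<Longrightarrow> K_conic \<K> m q n (\<Phi> i)"
  shows "K_conic \<K> m q n (\<lambda>f t u x. \<forall>i<k::nat. \<Phi> i f t u x)"
  using assms(2)
proof (induction k)
  case 0
  \<comment> \<open>The empty conjunction still needs a cone of the family; the trivial inequality 0
    \<le> 0 on the ray provides one. This also covers \<open>N = 0\<close> in the theorem.\<close>
  then show ?case using K_conic_nonneg[OF assms(1) linear_form_0] by simp
next
  case (Suc k)
  then have "K_conic \<K> m q n (\<lambda>f t u x. \<Phi> k f t u x \<and> (\<forall>i<k. \<Phi> i f t u x))"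
    by (intro K_conic_conj assms(1)) auto
  then show ?case by (rule K_conic_cong) (auto simp: less_Suc_eq)
qed

lemma K_conic_eq:
  assumes "cone_family \<K>" "linear_form m q n \<phi>" "linear_form m q n \<phi>'"
  shows "K_conic \<K> m q n (\<lambda>f t u x. \<phi> f t u x = \<phi>' f t u x)"
proof -
  have "K_conic \<K> m q n (\<lambda>f t u x. 0 \<le> \<phi> f t u x - \<phi>' f t u x \<and> 0 \<le> \<phi>' f t u x - \<phi> f t u x)"
    by (intro K_conic_conj K_conic_nonneg linear_form_diff assms)
  then show ?thesis by (rule K_conic_cong) auto
qed

text \<open>A constraint given in its own small dimensions is transported to the joint variables:
  \<open>F\<close>, \<open>T\<close>, \<open>U\<close>, \<open>V\<close> extract its arguments from
  the long vectors, and linear forms composed with matrices remain linear forms.\<close>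

lemma K_conic_conic_constraint:
  assumes "C \<in> \<K>" "C \<subseteq> carrier_vec r" "P \<in> carrier_mat r m'" "p \<in> carrier_vec r"
    "Q \<in> carrier_mat r q'" "R \<in> carrier_mat r n'" "s \<in> carrier_vec r"
    and F: "\<And>f t u x. F f t u x \<in> carrier_vec m'"
      "\<And>j. j < m' \<Longrightarrow> linear_form m q n (\<lambda>f t u x. F f t u x $ j)"
    and T: "linear_form m q n T"
    and U: "\<And>f t u x. U f t u x \<in> carrier_vec q'"
      "\<And>j. j < q' \<Longrightarrow> linear_form m q n (\<lambda>f t u x. U f t u x $ j)"
    and V: "\<And>f t u x. V f t u x \<in> carrier_vec n'"
      "\<And>j. j < n' \<Longrightarrow> linear_form m q n (\<lambda>f t u x. V f t u x $ j)"
  shows "K_conic \<K> m q n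
    (\<lambda>f t u x. conic_constraint C P p Q R s (F f t u x) (T f t u x) (U f t u x) (V f t u x))"
proof (rule K_conicI[where C = C and r = r and s = s and g = "\<lambda>f t u x.
      P *\<^sub>v F f t u x + T f t u x \<cdot>\<^sub>v p + Q *\<^sub>v U f t u x + R *\<^sub>v V f t u x"])
  fix l assume l: "l < r"
  have "linear_form m q n (\<lambda>f t u x. (P *\<^sub>v F f t u x) $ l + p $ l * T f t u x +
      (Q *\<^sub>v U f t u x) $ l + (R *\<^sub>v V f t u x) $ l)"
    using linear_form_mult_mat_vec[OF assms(3) l F] linear_form_mult_mat_vec[OF assms(5) l U]
      linear_form_mult_mat_vec[OF assms(6) l V] linear_form_mult[OF T]
    by (intro linear_form_add) auto
  moreover have "(P *\<^sub>v F f t u x + T f t u x \<cdot>\<^sub>v p + Q *\<^sub>v U f t u x + R *\<^sub>v V f t u x) $ l =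
      (P *\<^sub>v F f t u x) $ l + p $ l * T f t u x + (Q *\<^sub>v U f t u x) $ l + (R *\<^sub>v V f t u x) $ l"
    for f t u x
    using assms(3-6) l by simp
  ultimately show "linear_form m q n
      (\<lambda>f t u x. (P *\<^sub>v F f t u x + T f t u x \<cdot>\<^sub>v p + Q *\<^sub>v U f t u x + R *\<^sub>v V f t u x) $ l)"
    by simp
qed (use assms(1-7) in \<open>simp_all add: conic_constraint_def conic_lhs_carrier\<close>)

text \<open>A matrix without columns and the scalar 0 contribute only zero vectors. The two
  surviving terms appear in the order used by \<open>K_representable_set\<close>.\<close>

lemma conic_constraint_no_ft:
  assumes "P \<in> carrier_mat r 0" "p \<in> carrier_vec r" "Q \<in> carrier_mat r q" "R \<in> carrier_mat r n"
    "f \<in> carrier_vec 0"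
  shows "conic_constraint C P p Q R s f 0 u x \<longleftrightarrow> cone_le C (R *\<^sub>v x + Q *\<^sub>v u) s"
proof -
  have "P *\<^sub>v f + 0 \<cdot>\<^sub>v p + Q *\<^sub>v u + R *\<^sub>v x = R *\<^sub>v x + Q *\<^sub>v u"
    using assms by (intro eq_vecI) (simp_all add: scalar_prod_def)
  then show ?thesis by (simp add: conic_constraint_def)
qed

lemma K_conic_sum_system:
  assumes "cone_family \<K>" "\<And>i. i < N \<Longrightarrow> C i \<in> \<K>"
    "\<And>i. i < N \<Longrightarrow> \<exists>r. C i \<subseteq> carrier_vec r \<and> P i \<in> carrier_mat r (m i) \<and> p i \<in> carrier_vec r \<and>
       Q i \<in> carrier_mat r (q i) \<and> R i \<in> carrier_mat r (n i) \<and> s i \<in> carrier_vec r"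
  shows "K_conic \<K> (\<Sum>i<N. m i) (\<Sum>i<N. m i + Suc (q i)) (\<Sum>i<N. n i)
    (\<lambda>f t u x. sum_system N \<theta> C P p Q R s f t
       (\<lambda>i. aux_f m q i u) (\<lambda>i. aux_t m q i u) (\<lambda>i. aux_u m q i u) (\<lambda>i. vec_block n i x))"
    (is "K_conic \<K> ?m ?q ?n _")
proof -
  have u: "linear_form ?m ?q ?n (\<lambda>f t u x. vec_block (\<lambda>i. m i + Suc (q i)) i u $ j)"
    if "i < N" "j < m i + Suc (q i)" for i j
    using linear_form_index_u[OF offset_less_sum[of i N j "\<lambda>i. m i + Suc (q i)", OF that]] that
    by (simp add: vec_block_def)
  have f: "linear_form ?m ?q ?n (\<lambda>f t u x. vec_block m i f $ j)" if "i < N" "j < m i" for i j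
    using linear_form_index_f[OF offset_less_sum[of i N j m, OF that]] that by (simp add: vec_block_def)
  have x: "linear_form ?m ?q ?n (\<lambda>f t u x. vec_block n i x $ j)" if "i < N" "j < n i" for i j
    using linear_form_index_x[OF offset_less_sum[of i N j n, OF that]] that by (simp add: vec_block_def)
  have auxf: "linear_form ?m ?q ?n (\<lambda>f t u x. aux_f m q i u $ j)" if "i < N" "j < m i" for i j
    using u[of i j] that by (simp add: aux_f_def)
  have auxt: "linear_form ?m ?q ?n (\<lambda>f t u x. aux_t m q i u)" if "i < N" for i
    using u[of i "m i"] that by (simp add: aux_t_def)
  have auxu: "linear_form ?m ?q ?n (\<lambda>f t u x. aux_u m q i u $ j)" if "i < N" "j < q i" for i j
    using u[of i "m i + Suc j"] that by (simp add: aux_u_def)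
  have cc: "K_conic \<K> ?m ?q ?n (\<lambda>f t u x. conic_constraint (C i) (P i) (p i) (Q i) (R i) (s i)
      (aux_f m q i u) (aux_t m q i u) (aux_u m q i u) (vec_block n i x))" if i: "i < N" for i
  proof -
    obtain r where "C i \<subseteq> carrier_vec r" "P i \<in> carrier_mat r (m i)" "p i \<in> carrier_vec r"
      "Q i \<in> carrier_mat r (q i)" "R i \<in> carrier_mat r (n i)" "s i \<in> carrier_vec r"
      using assms(3)[OF i] by blast
    then show ?thesis
      by (rule K_conic_conic_constraint[OF assms(2)[OF i]]) (use i auxf auxt auxu x in simp_all)
  qed
  \<comment> \<open>The system in scalar form: the equation for \<open>f\<close> is written entry by
    entry, so that only linear equations and the given conic constraints occur.\<close>
  have "K_conic \<K> ?m ?q ?n (\<lambda>f t u x.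
      (\<forall>i<N. \<forall>j<m i. vec_block m i f $ j = \<theta> i * aux_f m q i u $ j) \<and>
      t = (\<Sum>i<N. \<theta> i * aux_t m q i u) \<and>
      (\<forall>i<N. conic_constraint (C i) (P i) (p i) (Q i) (R i) (s i)
         (aux_f m q i u) (aux_t m q i u) (aux_u m q i u) (vec_block n i x)))"
    by (intro K_conic_conj K_conic_all K_conic_eq linear_form_sum linear_form_mult linear_form_t
        assms(1) f auxf auxt cc) auto
  then show ?thesis
  proof (rule K_conic_cong)
    fix f u x :: "real vec" and t :: real
    assume f: "f \<in> carrier_vec ?m"
    have "f = vec_concat N (\<lambda>i. \<theta> i \<cdot>\<^sub>v aux_f m q i u) \<longleftrightarrow>
        (\<forall>i<N. vec_block m i f = \<theta> i \<cdot>\<^sub>v aux_f m q i u)"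
      by (rule eq_vec_concat_iff[OF f]) simp
    also have "\<dots> \<longleftrightarrow> (\<forall>i<N. \<forall>j<m i. vec_block m i f $ j = \<theta> i * aux_f m q i u $ j)"
      by (simp add: vec_eq_iff vec_block_def aux_f_def)
    finally show "sum_system N \<theta> C P p Q R s f t
       (\<lambda>i. aux_f m q i u) (\<lambda>i. aux_t m q i u) (\<lambda>i. aux_u m q i u) (\<lambda>i. vec_block n i x) \<longleftrightarrow>
      (\<forall>i<N. \<forall>j<m i. vec_block m i f $ j = \<theta> i * aux_f m q i u $ j) \<and>
      t = (\<Sum>i<N. \<theta> i * aux_t m q i u) \<and>
      (\<forall>i<N. conic_constraint (C i) (P i) (p i) (Q i) (R i) (s i)
         (aux_f m q i u) (aux_t m q i u) (aux_u m q i u) (vec_block n i x))"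
      by (simp only: sum_system_def)
  qed
qed

subsection \<open>Products of domains and sums of functions\<close>

lemma K_domain_carrier: "K_domain \<K> n X \<Longrightarrow> X \<subseteq> carrier_vec n"
  by (auto simp: K_domain_def K_representable_set_def)

lemma vec_convex_block_prod:
  assumes "\<And>i. i < N \<Longrightarrow> X i \<subseteq> carrier_vec (n i)" "\<And>i. i < N \<Longrightarrow> vec_convex (X i)"
  shows "vec_convex (block_prod N X)"
  unfolding vec_convex_def
proof (intro ballI allI impI)
  fix v w and a :: real
  assume vw: "v \<in> block_prod N X" "w \<in> block_prod N X" and a: "0 \<le> a \<and> a \<le> 1"
  note iff = block_prod_iff[of N X n, OF assms(1)]
  have "v \<in> carrier_vec (\<Sum>i<N. n i)" "w \<in> carrier_vec (\<Sum>i<N. n i)"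
    "\<And>i. i < N \<Longrightarrow> vec_block n i v \<in> X i \<and> vec_block n i w \<in> X i"
    using vw iff by auto
  then show "(1 - a) \<cdot>\<^sub>v v + a \<cdot>\<^sub>v w \<in> block_prod N X"
    using assms(2) a by (auto simp: iff vec_block_lincomb vec_convex_def)
qed

text \<open>
  The \<open>f\<close>-slot is given dimension \<open>0\<close> and \<open>t\<close> is set to \<open>0\<close>, so that the calculus of conic systems in
  \<open>(f, t, u, x)\<close> also covers representations of sets, which only involve \<open>(u, x)\<close>.
\<close>

lemma K_representable_block_prod:
  assumes "cone_family \<K>" "\<And>i. i < N \<Longrightarrow> K_representable_set \<K> (n i) (X i)"
  shows "K_representable_set \<K> (\<Sum>i<N. n i) (block_prod N X)"
proof -
  have "\<forall>i. \<exists>C r k A B c. i < N \<longrightarrow> C \<in> \<K> \<and>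
      C \<subseteq> carrier_vec r \<and> A \<in> carrier_mat r (n i) \<and> B \<in> carrier_mat r k \<and> c \<in> carrier_vec r \<and>
      X i = {x \<in> carrier_vec (n i). \<exists>u\<in>carrier_vec k. cone_le C (A *\<^sub>v x + B *\<^sub>v u) c}"
    using assms(2) unfolding K_representable_set_def by meson
  then obtain C r k A B c where i: "\<And>i. i < N \<Longrightarrow> C i \<in> \<K> \<and>
      C i \<subseteq> carrier_vec (r i) \<and> A i \<in> carrier_mat (r i) (n i) \<and> B i \<in> carrier_mat (r i) (k i) \<and>
      c i \<in> carrier_vec (r i) \<and>
      X i = {x \<in> carrier_vec (n i). \<exists>u\<in>carrier_vec (k i). cone_le (C i) (A i *\<^sub>v x + B i *\<^sub>v u) (c i)}"
    unfolding choice_iff by blast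
  let ?n = "\<Sum>i<N. n i" and ?k = "\<Sum>i<N. k i"
  have x: "linear_form 0 ?k ?n (\<lambda>f t u x. vec_block n i x $ j)" if "i < N" "j < n i" for i j
    using linear_form_index_x[OF offset_less_sum[of i N j n, OF that]] that by (simp add: vec_block_def)
  have u: "linear_form 0 ?k ?n (\<lambda>f t u x. vec_block k i u $ j)" if "i < N" "j < k i" for i j
    using linear_form_index_u[OF offset_less_sum[of i N j k, OF that]] that by (simp add: vec_block_def)
  have "K_conic \<K> 0 ?k ?n
      (\<lambda>f t u x. \<forall>i<N. cone_le (C i) (A i *\<^sub>v vec_block n i x + B i *\<^sub>v vec_block k i u) (c i))"
  proof (intro K_conic_all assms(1))
    fix j assume j: "j < N"
    have "K_conic \<K> 0 ?k ?n
        (\<lambda>f t u x. conic_constraint (C j) (0\<^sub>m (r j) 0) (0\<^sub>v (r j)) (B j) (A j) (c j) (0\<^sub>v 0) 0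
          (vec_block k j u) (vec_block n j x))"
      using i[OF j] j x u
      by (intro K_conic_conic_constraint[where r = "r j" and m' = 0 and q' = "k j" and n' = "n j"])
        (simp_all add: linear_form_0)
    then show "K_conic \<K> 0 ?k ?n
        (\<lambda>f t u x. cone_le (C j) (A j *\<^sub>v vec_block n j x + B j *\<^sub>v vec_block k j u) (c j))"
      by (rule K_conic_cong)
        (use i[OF j] in \<open>simp add: conic_constraint_no_ft[where r = "r j" and q = "k j" and n = "n j"]\<close>)
  qed
  then obtain C' r' P p Q R s where C': "C' \<in> \<K>" "C' \<subseteq> carrier_vec r'" "P \<in> carrier_mat r' 0"
    "p \<in> carrier_vec r'" "Q \<in> carrier_mat r' ?k" "R \<in> carrier_mat r' ?n" "s \<in> carrier_vec r'"
    and eq: "\<forall>f\<in>carrier_vec 0. \<forall>t. \<forall>u\<in>carrier_vec ?k. \<forall>x\<in>carrier_vec ?n.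
      (\<forall>i<N. cone_le (C i) (A i *\<^sub>v vec_block n i x + B i *\<^sub>v vec_block k i u) (c i)) \<longleftrightarrow>
      conic_constraint C' P p Q R s f t u x"
    unfolding K_conic_def by blast
  have eq': "cone_le C' (R *\<^sub>v x + Q *\<^sub>v u) s \<longleftrightarrow>
      (\<forall>i<N. cone_le (C i) (A i *\<^sub>v vec_block n i x + B i *\<^sub>v vec_block k i u) (c i))"
    if "u \<in> carrier_vec ?k" "x \<in> carrier_vec ?n" for u x
    using eq[rule_format, of "0\<^sub>v 0" u x 0] that
      conic_constraint_no_ft[OF C'(3-6), of "0\<^sub>v 0" C' s u x] by simp
  have X: "X i \<subseteq> carrier_vec (n i)" if "i < N" for i using i[OF that] by auto
  have "block_prod N X = {x \<in> carrier_vec ?n. \<exists>u\<in>carrier_vec ?k. cone_le C' (R *\<^sub>v x + Q *\<^sub>v u) s}"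
    (is "_ = ?S")
  proof (intro equalityI subsetI)
    fix x assume x: "x \<in> block_prod N X"
    then have xc: "x \<in> carrier_vec ?n" and xX: "\<forall>i<N. vec_block n i x \<in> X i"
      using block_prod_iff[of N X n, OF X] by auto
    \<comment> \<open>Each block constrains only its own part of \<open>u\<close>, so witnesses can
      be picked separately and concatenated.\<close>
    have "\<forall>i. \<exists>u. i < N \<longrightarrow> u \<in> carrier_vec (k i) \<and>
        cone_le (C i) (A i *\<^sub>v vec_block n i x + B i *\<^sub>v u) (c i)"
      using xX i by blast
    then obtain us where us: "\<And>i. i < N \<Longrightarrow> us i \<in> carrier_vec (k i) \<and>
        cone_le (C i) (A i *\<^sub>v vec_block n i x + B i *\<^sub>v us i) (c i)"
      unfolding choice_iff by blast
    have "vec_concat N us \<in> carrier_vec ?k" using us by (intro vec_concat_carrier) auto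
    moreover have "vec_block k i (vec_concat N us) = us i" if "i < N" for i
      using us that by (intro vec_block_concat) auto
    ultimately have "cone_le C' (R *\<^sub>v x + Q *\<^sub>v vec_concat N us) s"
      using eq'[of "vec_concat N us" x] xc us by simp
    then show "x \<in> ?S" using xc \<open>vec_concat N us \<in> carrier_vec ?k\<close> by blast
  next
    fix x assume "x \<in> ?S"
    then obtain u where u: "x \<in> carrier_vec ?n" "u \<in> carrier_vec ?k"
      "cone_le C' (R *\<^sub>v x + Q *\<^sub>v u) s" by blast
    have "vec_block n j x \<in> X j" if "j < N" for j
      using i[OF that] eq'[OF u(2,1)] u(3) that vec_block_carrier[of n j x]
        vec_block_carrier[of k j u] by blast
    then show "x \<in> block_prod N X" using u(1) block_prod_iff[of N X n, OF X] by blast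
  qed
  then show ?thesis unfolding K_representable_set_def using C' by blast
qed

lemma K_domain_block_prod:
  assumes "cone_family \<K>" "\<And>i. i < N \<Longrightarrow> K_domain \<K> (n i) (X i)"
  shows "K_domain \<K> (\<Sum>i<N. n i) (block_prod N X)"
proof -
  have "\<forall>i<N. \<exists>x. x \<in> X i" using assms(2) unfolding K_domain_def by blast
  then obtain xs where "\<forall>i<N. xs i \<in> X i" by metis
  then have "vec_concat N xs \<in> block_prod N X" unfolding block_prod_def by blast
  then show ?thesis
    using vec_convex_block_prod[of N X n] K_representable_block_prod[OF assms(1), of N n X]
      K_domain_carrier[OF assms(2)] assms(2)
    unfolding K_domain_def by blast
qed

text \<open>Stated for arbitrary \<open>g\<close> because it serves twice: for \<psi>_i with the
  second argument fixed, and for -\<psi>_i with the first argument fixed.\<close>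

lemma vec_convex_on_block_sum:
  assumes "\<And>i. i < N \<Longrightarrow> X i \<subseteq> carrier_vec (n i)" "\<And>i. i < N \<Longrightarrow> 0 \<le> \<theta> i"
    "\<And>i. i < N \<Longrightarrow> vec_convex_on (X i) (g i)"
  shows "vec_convex_on (block_prod N X) (\<lambda>x. \<Sum>i<N. \<theta> i * g i (vec_block n i x))"
  unfolding vec_convex_on_def
proof (intro ballI allI impI)
  fix v w and a :: real
  assume vw: "v \<in> block_prod N X" "w \<in> block_prod N X" and a: "0 \<le> a \<and> a \<le> 1"
  note iff = block_prod_iff[of N X n, OF assms(1)]
  have c: "v \<in> carrier_vec (\<Sum>i<N. n i)" "w \<in> carrier_vec (\<Sum>i<N. n i)"
    and b: "\<And>i. i < N \<Longrightarrow> vec_block n i v \<in> X i" "\<And>i. i < N \<Longrightarrow> vec_block n i w \<in> X i"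
    using vw iff by auto
  have "\<theta> i * g i (vec_block n i ((1 - a) \<cdot>\<^sub>v v + a \<cdot>\<^sub>v w)) \<le>
      \<theta> i * ((1 - a) * g i (vec_block n i v) + a * g i (vec_block n i w))" if i: "i < N" for i
    using assms(3)[OF i] b[OF i] a unfolding vec_convex_on_def
    by (simp add: vec_block_lincomb[OF i c] mult_left_mono[OF _ assms(2)[OF i]])
  then have "(\<Sum>i<N. \<theta> i * g i (vec_block n i ((1 - a) \<cdot>\<^sub>v v + a \<cdot>\<^sub>v w))) \<le>
      (\<Sum>i<N. \<theta> i * ((1 - a) * g i (vec_block n i v) + a * g i (vec_block n i w)))"
    by (intro sum_mono) simp
  also have "\<dots> = (1 - a) * (\<Sum>i<N. \<theta> i * g i (vec_block n i v)) +
      a * (\<Sum>i<N. \<theta> i * g i (vec_block n i w))"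
    unfolding sum_distrib_left sum.distrib[symmetric] by (simp add: algebra_simps)
  finally show "(\<Sum>i<N. \<theta> i * g i (vec_block n i ((1 - a) \<cdot>\<^sub>v v + a \<cdot>\<^sub>v w))) \<le> \<dots>" .
qed

section \<open>Continuity of block extraction and of the weighted sum\<close>

lemma topspace_vec_topology [simp]: "topspace (vec_topology n) = carrier_vec n"
  by (auto simp: vec_topology_def topspace_pullback_topology)

lemma continuous_map_vec_index:
  assumes "j < n"
  shows "continuous_map (vec_topology n) euclideanreal (\<lambda>v. v $ j)"
proof -
  have "continuous_map (vec_topology n) euclideanreal ((\<lambda>x. x j) \<circ> (\<lambda>v. \<lambda>j\<in>{..<n}. v $ j))"
    unfolding vec_topology_def
    using assms by (intro continuous_map_pullback continuous_map_product_projection) simp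
  then show ?thesis using assms by (simp add: o_def)
qed

text \<open>Continuity into the pulled-back product topology is tested coordinatewise, and
  coordinate \<open>j\<close> of a block is a coordinate of the whole vector, shifted by the offset
  of the block.\<close>

lemma continuous_map_vec_block:
  assumes "i < N"
  shows "continuous_map (vec_topology (\<Sum>k<N. n k)) (vec_topology (n i)) (vec_block n i)"
  unfolding vec_topology_def[of "n i"]
proof (rule continuous_map_pullback')
  show "continuous_map (vec_topology (\<Sum>k<N. n k)) (powertop_real {..<n i})
      ((\<lambda>v. \<lambda>j\<in>{..<n i}. v $ j) \<circ> vec_block n i)"
    unfolding continuous_map_componentwise
    using continuous_map_vec_index[OF offset_less_sum[OF assms, of _ n]]
    by (auto simp: vec_block_def)
qed auto

lemma convex_concave_continuous_weighted_sum:
  assumes "\<And>i. i < N \<Longrightarrow> 0 \<le> \<theta> i"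
    "\<And>i. i < N \<Longrightarrow> X i \<subseteq> carrier_vec (n i)" "\<And>i. i < N \<Longrightarrow> Y i \<subseteq> carrier_vec (m i)"
    "\<And>i. i < N \<Longrightarrow> convex_concave_continuous (n i) (m i) (X i) (Y i) (\<psi> i)"
  shows "convex_concave_continuous (\<Sum>i<N. n i) (\<Sum>i<N. m i) (block_prod N X) (block_prod N Y)
    (weighted_sum N \<theta> n m \<psi>)"
  unfolding convex_concave_continuous_def
proof (intro conjI ballI)
  note iffY = block_prod_iff[of N Y m, OF assms(3)]
  fix y assume y: "y \<in> block_prod N Y"
  have "vec_convex_on (block_prod N X)
      (\<lambda>x. \<Sum>i<N. \<theta> i * (\<lambda>v. \<psi> i v (vec_block m i y)) (vec_block n i x))"
    using assms y iffY unfolding convex_concave_continuous_def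
    by (intro vec_convex_on_block_sum) auto
  then show "vec_convex_on (block_prod N X) (\<lambda>x. weighted_sum N \<theta> n m \<psi> x y)"
    by (simp add: weighted_sum_def)
next
  note iffX = block_prod_iff[of N X n, OF assms(2)]
  fix x assume x: "x \<in> block_prod N X"
  have "vec_convex_on (block_prod N Y)
      (\<lambda>y. \<Sum>i<N. \<theta> i * (\<lambda>w. - \<psi> i (vec_block n i x) w) (vec_block m i y))"
    using assms x iffX unfolding convex_concave_continuous_def
    by (intro vec_convex_on_block_sum) auto
  then show "vec_convex_on (block_prod N Y) (\<lambda>y. - weighted_sum N \<theta> n m \<psi> x y)"
    by (simp add: weighted_sum_def sum_negf)
next
  note iffX = block_prod_iff[of N X n, OF assms(2)]
  note iffY = block_prod_iff[of N Y m, OF assms(3)]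
  let ?T = "subtopology (prod_topology (vec_topology (\<Sum>i<N. n i)) (vec_topology (\<Sum>i<N. m i)))
      (block_prod N X \<times> block_prod N Y)"
  have c: "continuous_map ?T euclideanreal
      (\<lambda>z. \<psi> i (vec_block n i (fst z)) (vec_block m i (snd z)))" if i: "i < N" for i
  proof -
    have "continuous_map ?T (prod_topology (vec_topology (n i)) (vec_topology (m i)))
        (\<lambda>z. ((vec_block n i \<circ> fst) z, (vec_block m i \<circ> snd) z))"
      by (intro continuous_map_pairedI continuous_map_from_subtopology
          continuous_map_compose[OF continuous_map_fst continuous_map_vec_block[OF i]]
          continuous_map_compose[OF continuous_map_snd continuous_map_vec_block[OF i]])
    \<comment> \<open>\<psi>_i is continuous only relative to \<open>X i \<times> Y i\<close>, so
      the pair of block maps must be seen as a map into that subspace before composing.\<close>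
    then have "continuous_map ?T
        (subtopology (prod_topology (vec_topology (n i)) (vec_topology (m i))) (X i \<times> Y i))
        (\<lambda>z. ((vec_block n i \<circ> fst) z, (vec_block m i \<circ> snd) z))"
      by (rule continuous_map_into_subtopology) (use i iffX iffY in auto)
    moreover have "continuous_map
        (subtopology (prod_topology (vec_topology (n i)) (vec_topology (m i))) (X i \<times> Y i))
        euclideanreal (\<lambda>(x, y). \<psi> i x y)"
      using assms(4)[OF i] by (simp add: convex_concave_continuous_def)
    ultimately show ?thesis using continuous_map_compose by (fastforce simp: o_def)
  qed
  have "continuous_map ?T euclideanreal
      (\<lambda>z. \<Sum>i<N. \<theta> i * \<psi> i (vec_block n i (fst z)) (vec_block m i (snd z)))"
    by (intro continuous_map_sum continuous_map_real_mult_left c) auto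
  then show "continuous_map ?T euclideanreal (\<lambda>(x, y). weighted_sum N \<theta> n m \<psi> x y)"
    by (simp add: weighted_sum_def case_prod_unfold)
qed

section \<open>Infimum of a weighted sum over independent variables\<close>

lemma INF_weighted_sum:
  fixes v :: "nat \<Rightarrow> real" and val :: "nat \<Rightarrow> 'a \<Rightarrow> real"
  assumes "\<And>i. i < N \<Longrightarrow> 0 \<le> \<theta> i" "\<And>i. i < N \<Longrightarrow> ereal (v i) = (INF z\<in>A i. ereal (val i z))"
  shows "ereal (\<Sum>i<N. \<theta> i * v i) =
    (INF zs\<in>{zs. \<forall>i<N. zs i \<in> A i}. ereal (\<Sum>i<N. \<theta> i * val i (zs i)))"
proof (rule antisym)
  show "ereal (\<Sum>i<N. \<theta> i * v i) \<le>
      (INF zs\<in>{zs. \<forall>i<N. zs i \<in> A i}. ereal (\<Sum>i<N. \<theta> i * val i (zs i)))"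
  proof (rule INF_greatest)
    fix zs assume zs: "zs \<in> {zs. \<forall>i<N. zs i \<in> A i}"
    have "v i \<le> val i (zs i)" if "i < N" for i
    proof -
      have "ereal (v i) \<le> ereal (val i (zs i))"
        unfolding assms(2)[OF that] using zs that by (intro INF_lower) simp
      then show ?thesis by simp
    qed
    then show "ereal (\<Sum>i<N. \<theta> i * v i) \<le> ereal (\<Sum>i<N. \<theta> i * val i (zs i))"
      using assms(1) by (auto intro!: sum_mono mult_left_mono)
  qed
  show "(INF zs\<in>{zs. \<forall>i<N. zs i \<in> A i}. ereal (\<Sum>i<N. \<theta> i * val i (zs i))) \<le>
      ereal (\<Sum>i<N. \<theta> i * v i)"
  proof (rule ereal_le_epsilon2)
    fix e :: real assume e: "0 < e"
    define T where "T = (\<Sum>i<N. \<theta> i)"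
    have T: "0 \<le> T" unfolding T_def using assms(1) by (intro sum_nonneg) auto
    \<comment> \<open>Errors of size \<open>d\<close> in all summands add up to
      \<open>T * d\<close>, which is at most \<open>e\<close>. The summand 1 in the denominator
      keeps it positive when all weights vanish or \<open>N = 0\<close>.\<close>
    define d where "d = e / (1 + T)"
    have d: "0 < d" "T * d \<le> e" using e T by (simp_all add: d_def field_simps)
    \<comment> \<open>The infimum over \<open>A i\<close> is the real number \<open>v i\<close>,
      hence strictly below \<open>v i + d\<close>, and some member of \<open>A i\<close> stays below
      this bound; in particular \<open>A i\<close> is nonempty.\<close>
    have "\<forall>i. \<exists>z. i < N \<longrightarrow> z \<in> A i \<and> val i z < v i + d"
    proof
      fix i
      show "\<exists>z. i < N \<longrightarrow> z \<in> A i \<and> val i z < v i + d"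
      proof (cases "i < N")
        case True
        have "(INF z\<in>A i. ereal (val i z)) < ereal (v i + d)"
          using assms(2)[OF True] d by (metis ereal_less(1) less_add_same_cancel1 less_ereal.simps(1))
        then show ?thesis by (auto simp: INF_less_iff)
      qed simp
    qed
    then obtain zs where zs: "\<And>i. i < N \<Longrightarrow> zs i \<in> A i \<and> val i (zs i) < v i + d"
      unfolding choice_iff by blast
    have "(INF zs\<in>{zs. \<forall>i<N. zs i \<in> A i}. ereal (\<Sum>i<N. \<theta> i * val i (zs i))) \<le>
        ereal (\<Sum>i<N. \<theta> i * val i (zs i))"
      using zs by (intro INF_lower) auto
    also have "(\<Sum>i<N. \<theta> i * val i (zs i)) \<le> (\<Sum>i<N. \<theta> i * (v i + d))"
      using zs assms(1) by (intro sum_mono mult_left_mono) (auto intro: less_imp_le)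
    also have "\<dots> = (\<Sum>i<N. \<theta> i * v i) + T * d"
      by (simp add: T_def distrib_left sum.distrib sum_distrib_right)
    also have "\<dots> \<le> (\<Sum>i<N. \<theta> i * v i) + e" using d by simp
    finally show "(INF zs\<in>{zs. \<forall>i<N. zs i \<in> A i}. ereal (\<Sum>i<N. \<theta> i * val i (zs i))) \<le>
        ereal (\<Sum>i<N. \<theta> i * v i) + ereal e" by simp
  qed
qed

text \<open>The equations of \<open>sum_system\<close> determine \<open>f\<close> and
  \<open>t\<close> from the families, and the scalar product splits over blocks. The joint objective
  thus takes exactly the values of weighted sums with independently chosen feasible triples.\<close>

lemma INF_sum_system:
  fixes v :: "nat \<Rightarrow> real"
  assumes "\<And>i. i < N \<Longrightarrow> 0 \<le> \<theta> i" "\<And>i. i < N \<Longrightarrow> ys i \<in> carrier_vec (m i)"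
    "\<And>i. i < N \<Longrightarrow> ereal (v i) =
       (INF (f, t, u) \<in> {(f, t, u). f \<in> carrier_vec (m i) \<and> u \<in> carrier_vec (q i) \<and>
          conic_constraint (C i) (P i) (p i) (Q i) (R i) (s i) f t u (xs i)}.
          ereal (scalar_prod f (ys i) + t))"
  shows "ereal (\<Sum>i<N. \<theta> i * v i) =
          (INF (f, t, fs, ts, us) \<in> {(f, t, fs, ts, us).
               f \<in> carrier_vec (\<Sum>i<N. m i) \<and>
               (\<forall>i<N. fs i \<in> carrier_vec (m i) \<and> us i \<in> carrier_vec (q i)) \<and>
               sum_system N \<theta> C P p Q R s f t fs ts us xs}.
             ereal (scalar_prod f (vec_concat N ys) + t))"
    (is "_ = (INF z\<in>?S. ?val z)")
proof -
  define A where "A i = {(f, t, u). f \<in> carrier_vec (m i) \<and> u \<in> carrier_vec (q i) \<and>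
    conic_constraint (C i) (P i) (p i) (Q i) (R i) (s i) f t u (xs i)}" for i
  define val where "val i = (\<lambda>(f, t, u :: real vec). scalar_prod f (ys i) + t)" for i
  have sum: "scalar_prod (vec_concat N (\<lambda>i. \<theta> i \<cdot>\<^sub>v fs i)) (vec_concat N ys) + (\<Sum>i<N. \<theta> i * ts i) =
      (\<Sum>i<N. \<theta> i * val i (fs i, ts i, us i))"
    if "\<forall>i<N. fs i \<in> carrier_vec (m i)" for fs ts us
  proof -
    have "scalar_prod (vec_concat N (\<lambda>i. \<theta> i \<cdot>\<^sub>v fs i)) (vec_concat N ys) =
        (\<Sum>i<N. scalar_prod (\<theta> i \<cdot>\<^sub>v fs i) (ys i))"
      using that assms(2) by (intro scalar_prod_vec_concat[where n = m]) auto
    also have "\<dots> = (\<Sum>i<N. \<theta> i * scalar_prod (fs i) (ys i))"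
    proof (intro sum.cong refl)
      fix i assume "i \<in> {..<N}"
      then have "dim_vec (fs i) = dim_vec (ys i)" using that assms(2) by (metis carrier_vecD lessThan_iff)
      then show "scalar_prod (\<theta> i \<cdot>\<^sub>v fs i) (ys i) = \<theta> i * scalar_prod (fs i) (ys i)"
        by (rule scalar_prod_smult_left)
    qed
    finally show ?thesis by (simp add: val_def distrib_left sum.distrib)
  qed
  have "?val ` ?S = (\<lambda>zs. ereal (\<Sum>i<N. \<theta> i * val i (zs i))) ` {zs. \<forall>i<N. zs i \<in> A i}"
    (is "_ = ?W ` ?Z")
  proof (intro equalityI subsetI)
    fix e assume "e \<in> ?val ` ?S"
    then obtain f t fs ts us where e: "e = ereal (scalar_prod f (vec_concat N ys) + t)"
      "\<forall>i<N. fs i \<in> carrier_vec (m i) \<and> us i \<in> carrier_vec (q i)"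
      "sum_system N \<theta> C P p Q R s f t fs ts us xs" by auto
    then have "e = ?W (\<lambda>i. (fs i, ts i, us i))"
      using sum[of fs ts us] by (simp add: sum_system_def)
    moreover have "(\<lambda>i. (fs i, ts i, us i)) \<in> ?Z"
      using e by (simp add: A_def sum_system_def)
    ultimately show "e \<in> ?W ` ?Z" by (rule image_eqI)
  next
    fix e assume "e \<in> ?W ` ?Z"
    then obtain zs where zs: "\<forall>i<N. zs i \<in> A i" "e = ?W zs" by blast
    define fs ts us where "fs i = fst (zs i)" and "ts i = fst (snd (zs i))"
      and "us i = snd (snd (zs i))" for i
    have z: "zs i = (fs i, ts i, us i)" for i by (simp add: fs_def ts_def us_def)
    let ?f = "vec_concat N (\<lambda>i. \<theta> i \<cdot>\<^sub>v fs i)" and ?t = "\<Sum>i<N. \<theta> i * ts i"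
    have fs: "\<forall>i<N. fs i \<in> carrier_vec (m i)" using zs z by (auto simp: A_def)
    then have "?f \<in> carrier_vec (\<Sum>i<N. m i)" by (intro vec_concat_carrier) auto
    then have "(?f, ?t, fs, ts, us) \<in> ?S"
      using zs(1) by (auto simp: z A_def sum_system_def)
    moreover have "e = ?val (?f, ?t, fs, ts, us)"
      using zs(2) sum[OF fs, of ts us] by (simp add: z)
    ultimately show "e \<in> ?val ` ?S" by (rule rev_image_eqI)
  qed
  moreover have "ereal (\<Sum>i<N. \<theta> i * v i) = (INF zs\<in>?Z. ?W zs)"
  proof (rule INF_weighted_sum[OF assms(1)])
    show "ereal (v i) = (INF z\<in>A i. ereal (val i z))" if "i < N" for i
      using assms(3)[OF that] by (simp add: A_def val_def case_prod_unfold)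
  qed
  ultimately show ?thesis by simp
qed

text \<open>The equivalence in the last conjunct ties the representation to the displayed system:
  the existential cannot be met by an unrelated representation of the same function.\<close>

theorem mainTheorem5:
  fixes \<K> :: "real vec set set"
    and N :: nat
    and \<theta> :: "nat \<Rightarrow> real"
    and n m q :: "nat \<Rightarrow> nat"
    and X Y :: "nat \<Rightarrow> real vec set"
    and \<psi> :: "nat \<Rightarrow> real vec \<Rightarrow> real vec \<Rightarrow> real"
    and C :: "nat \<Rightarrow> real vec set"
    and P Q R :: "nat \<Rightarrow> real mat"
    and p s :: "nat \<Rightarrow> real vec"
  assumes "cone_family \<K>"
    and "\<And>i. i < N \<Longrightarrow> \<theta> i > 0"
    and "\<And>i. i < N \<Longrightarrow>
          K_representation \<K> (n i) (m i) (q i) (X i) (Y i) (\<psi> i) (C i) (P i) (p i) (Q i) (R i) (s i)"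
  shows
    "(\<forall>xs ys. (\<forall>i<N. xs i \<in> X i) \<and> (\<forall>i<N. ys i \<in> Y i) \<longrightarrow>
        ereal (weighted_sum N \<theta> n m \<psi> (vec_concat N xs) (vec_concat N ys)) =
          (INF (f, t, fs, ts, us) \<in> {(f, t, fs, ts, us).
               f \<in> carrier_vec (\<Sum>i<N. m i) \<and>
               (\<forall>i<N. fs i \<in> carrier_vec (m i) \<and> us i \<in> carrier_vec (q i)) \<and>
               sum_system N \<theta> C P p Q R s f t fs ts us xs}.
             ereal (scalar_prod f (vec_concat N ys) + t)))
     \<and>
     (\<exists>C' P' p' Q' R' s'.
        K_representation \<K> (\<Sum>i<N. n i) (\<Sum>i<N. m i) (\<Sum>i<N. m i + Suc (q i))
          (block_prod N X) (block_prod N Y) (weighted_sum N \<theta> n m \<psi>) C' P' p' Q' R' s' \<and>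
        (\<forall>f t fs ts us xs.
           f \<in> carrier_vec (\<Sum>i<N. m i) \<and>
           (\<forall>i<N. fs i \<in> carrier_vec (m i) \<and> us i \<in> carrier_vec (q i) \<and>
                  xs i \<in> carrier_vec (n i)) \<longrightarrow>
           (conic_constraint C' P' p' Q' R' s' f t (stack_aux N fs ts us) (vec_concat N xs) \<longleftrightarrow>
            sum_system N \<theta> C P p Q R s f t fs ts us xs)))"
proof -
  have rep: "K_domain \<K> (n i) (X i)" "K_domain \<K> (m i) (Y i)"
    "convex_concave_continuous (n i) (m i) (X i) (Y i) (\<psi> i)" "C i \<in> \<K>"
    "\<exists>r. C i \<subseteq> carrier_vec r \<and> P i \<in> carrier_mat r (m i) \<and> p i \<in> carrier_vec r \<and>
       Q i \<in> carrier_mat r (q i) \<and> R i \<in> carrier_mat r (n i) \<and> s i \<in> carrier_vec r"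
    "\<And>x y. x \<in> X i \<Longrightarrow> y \<in> Y i \<Longrightarrow> ereal (\<psi> i x y) =
       (INF (f, t, u) \<in> {(f, t, u). f \<in> carrier_vec (m i) \<and> u \<in> carrier_vec (q i) \<and>
          conic_constraint (C i) (P i) (p i) (Q i) (R i) (s i) f t u x}.
          ereal (scalar_prod f y + t))" if "i < N" for i
    using assms(3)[OF that] unfolding K_representation_def by blast+
  note XY = K_domain_carrier[OF rep(1)] K_domain_carrier[OF rep(2)]
  have \<theta>: "0 \<le> \<theta> i" if "i < N" for i using assms(2)[OF that] by simp
  let ?n = "\<Sum>i<N. n i" and ?m = "\<Sum>i<N. m i" and ?q = "\<Sum>i<N. m i + Suc (q i)"
  define S where "S xs = {(f, t, fs, ts, us). f \<in> carrier_vec ?m \<and>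
     (\<forall>i<N. fs i \<in> carrier_vec (m i) \<and> us i \<in> carrier_vec (q i)) \<and>
     sum_system N \<theta> C P p Q R s f t fs ts us xs}" for xs
  have INF: "ereal (weighted_sum N \<theta> n m \<psi> (vec_concat N xs) (vec_concat N ys)) =
      (INF (f, t, fs, ts, us) \<in> S xs. ereal (scalar_prod f (vec_concat N ys) + t))"
    if xs: "\<forall>i<N. xs i \<in> X i" and ys: "\<forall>i<N. ys i \<in> Y i" for xs ys
  proof -
    have xc: "\<And>i. i < N \<Longrightarrow> xs i \<in> carrier_vec (n i)" and yc: "\<And>i. i < N \<Longrightarrow> ys i \<in> carrier_vec (m i)"
      using XY xs ys by blast+
    have "weighted_sum N \<theta> n m \<psi> (vec_concat N xs) (vec_concat N ys) =
        (\<Sum>i<N. \<theta> i * \<psi> i (xs i) (ys i))"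
      unfolding weighted_sum_def
      using vec_block_concat[of N xs n, OF xc] vec_block_concat[of N ys m, OF yc] by simp
    also have "ereal \<dots> = (INF (f, t, fs, ts, us) \<in> S xs. ereal (scalar_prod f (vec_concat N ys) + t))"
      unfolding S_def
      using INF_sum_system[of N \<theta> ys m "\<lambda>i. \<psi> i (xs i) (ys i)" q C P p Q R s xs] \<theta> yc rep(6) xs ys
      by blast
    finally show ?thesis .
  qed
  obtain C' r P' p' Q' R' s' where C': "C' \<in> \<K>" "C' \<subseteq> carrier_vec r" "P' \<in> carrier_mat r ?m"
    "p' \<in> carrier_vec r" "Q' \<in> carrier_mat r ?q" "R' \<in> carrier_mat r ?n" "s' \<in> carrier_vec r"
    and sys: "\<forall>f\<in>carrier_vec ?m. \<forall>t. \<forall>u\<in>carrier_vec ?q. \<forall>x\<in>carrier_vec ?n.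
      sum_system N \<theta> C P p Q R s f t
        (\<lambda>i. aux_f m q i u) (\<lambda>i. aux_t m q i u) (\<lambda>i. aux_u m q i u) (\<lambda>i. vec_block n i x) \<longleftrightarrow>
      conic_constraint C' P' p' Q' R' s' f t u x"
    using K_conic_sum_system[of \<K> N C P m p Q q R n s \<theta>, OF assms(1) rep(4,5)] unfolding K_conic_def by blast
  have stack: "conic_constraint C' P' p' Q' R' s' f t (stack_aux N fs ts us) (vec_concat N xs) \<longleftrightarrow>
      sum_system N \<theta> C P p Q R s f t fs ts us xs"
    if f: "f \<in> carrier_vec ?m" and c: "\<And>i. i < N \<Longrightarrow> fs i \<in> carrier_vec (m i)"
      "\<And>i. i < N \<Longrightarrow> us i \<in> carrier_vec (q i)" "\<And>i. i < N \<Longrightarrow> xs i \<in> carrier_vec (n i)"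
    for f t fs ts us xs
  proof -
    let ?u = "stack_aux N fs ts us" and ?x = "vec_concat N xs"
    have "?u \<in> carrier_vec ?q" by (rule stack_aux_carrier[OF c(1,2)])
    moreover have "?x \<in> carrier_vec ?n" by (rule vec_concat_carrier[OF c(3)])
    ultimately have "conic_constraint C' P' p' Q' R' s' f t ?u ?x \<longleftrightarrow> sum_system N \<theta> C P p Q R s f t
        (\<lambda>i. aux_f m q i ?u) (\<lambda>i. aux_t m q i ?u) (\<lambda>i. aux_u m q i ?u) (\<lambda>i. vec_block n i ?x)"
      using sys f by simp
    also have "\<dots> \<longleftrightarrow> sum_system N \<theta> C P p Q R s f t fs ts us xs"
      by (rule sum_system_cong)
        (simp_all add: aux_f_stack_aux[OF c(1,2)] aux_t_stack_aux[OF c(1,2)]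
          aux_u_stack_aux[OF c(1,2)] vec_block_concat[of N xs n, OF c(3)])
    finally show ?thesis .
  qed
  have "K_representation \<K> ?n ?m ?q (block_prod N X) (block_prod N Y) (weighted_sum N \<theta> n m \<psi>)
      C' P' p' Q' R' s'"
    unfolding K_representation_def
  proof (intro conjI ballI)
    show "K_domain \<K> ?n (block_prod N X)" "K_domain \<K> ?m (block_prod N Y)"
      by (intro K_domain_block_prod assms(1) rep(1,2); assumption)+
    show "convex_concave_continuous ?n ?m (block_prod N X) (block_prod N Y) (weighted_sum N \<theta> n m \<psi>)"
      by (rule convex_concave_continuous_weighted_sum[OF \<theta> XY rep(3)])
    show "C' \<in> \<K>" by fact
    show "\<exists>r. C' \<subseteq> carrier_vec r \<and> P' \<in> carrier_mat r ?m \<and> p' \<in> carrier_vec r \<and>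
        Q' \<in> carrier_mat r ?q \<and> R' \<in> carrier_mat r ?n \<and> s' \<in> carrier_vec r"
      using C' by blast
    fix x y assume "x \<in> block_prod N X" "y \<in> block_prod N Y"
    then obtain xs ys where x: "x = vec_concat N xs" "\<forall>i<N. xs i \<in> X i"
      and y: "y = vec_concat N ys" "\<forall>i<N. ys i \<in> Y i" by (auto simp: block_prod_def)
    have xc: "\<And>i. i < N \<Longrightarrow> xs i \<in> carrier_vec (n i)" using XY x by blast
    define S' where "S' = {(f, t, u). f \<in> carrier_vec ?m \<and> u \<in> carrier_vec ?q \<and>
        conic_constraint C' P' p' Q' R' s' f t u x}"
    let ?val = "\<lambda>(f, t, fs :: nat \<Rightarrow> real vec, ts :: nat \<Rightarrow> real, us :: nat \<Rightarrow> real vec).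
        ereal (scalar_prod f y + t)"
      and ?val' = "\<lambda>(f, t, u :: real vec). ereal (scalar_prod f y + t)"
    \<comment> \<open>Neither objective depends on the auxiliary variables beyond \<open>f\<close>
      and \<open>t\<close>, so matching feasible points with equal \<open>f\<close> and
      \<open>t\<close> suffices: stacking in one direction, unstacking in the other.\<close>
    have "?val ` S xs = ?val' ` S'"
    proof (intro equalityI subsetI)
      fix e assume "e \<in> ?val ` S xs"
      then obtain f t fs ts us where e: "e = ereal (scalar_prod f y + t)"
        and f: "f \<in> carrier_vec ?m" and fu: "\<forall>i<N. fs i \<in> carrier_vec (m i) \<and> us i \<in> carrier_vec (q i)"
        and sys: "sum_system N \<theta> C P p Q R s f t fs ts us xs"
        by (auto simp: S_def)
      have fs: "\<And>i. i < N \<Longrightarrow> fs i \<in> carrier_vec (m i)"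
        and us: "\<And>i. i < N \<Longrightarrow> us i \<in> carrier_vec (q i)" using fu by auto
      have "(f, t, stack_aux N fs ts us) \<in> S'"
        using stack[OF f fs us xc, of t ts] stack_aux_carrier[of N fs m us q ts, OF fs us] f sys by (simp add: S'_def x)
      then show "e \<in> ?val' ` S'" using e by force
    next
      fix e assume "e \<in> ?val' ` S'"
      then obtain f t u where e: "e = ereal (scalar_prod f y + t)"
        and S': "f \<in> carrier_vec ?m" "u \<in> carrier_vec ?q" "conic_constraint C' P' p' Q' R' s' f t u x"
        by (auto simp: S'_def)
      let ?fs = "\<lambda>i. aux_f m q i u" and ?ts = "\<lambda>i. aux_t m q i u" and ?us = "\<lambda>i. aux_u m q i u"
      have "sum_system N \<theta> C P p Q R s f t ?fs ?ts ?us xs"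
        using stack[OF S'(1) _ _ xc, of ?fs ?us t ?ts] S'(3) stack_aux_aux[OF S'(2)] by (simp add: x)
      then have "(f, t, ?fs, ?ts, ?us) \<in> S xs" using S'(1) by (simp add: S_def)
      then show "e \<in> ?val ` S xs" using e by force
    qed
    then show "ereal (weighted_sum N \<theta> n m \<psi> x y) =
        (INF (f, t, u) \<in> {(f, t, u). f \<in> carrier_vec ?m \<and> u \<in> carrier_vec ?q \<and>
           conic_constraint C' P' p' Q' R' s' f t u x}. ereal (scalar_prod f y + t))"
      using INF[OF x(2) y(2)] unfolding S'_def by (simp add: x(1) y(1))
  qed
  with stack have "\<exists>C' P' p' Q' R' s'.
      K_representation \<K> ?n ?m ?q (block_prod N X) (block_prod N Y) (weighted_sum N \<theta> n m \<psi>)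
        C' P' p' Q' R' s' \<and>
      (\<forall>f t fs ts us xs. f \<in> carrier_vec ?m \<and>
         (\<forall>i<N. fs i \<in> carrier_vec (m i) \<and> us i \<in> carrier_vec (q i) \<and> xs i \<in> carrier_vec (n i)) \<longrightarrow>
         (conic_constraint C' P' p' Q' R' s' f t (stack_aux N fs ts us) (vec_concat N xs) \<longleftrightarrow>
          sum_system N \<theta> C P p Q R s f t fs ts us xs))"
    by (intro exI conjI allI impI) auto
  with INF show ?thesis unfolding S_def by (intro conjI allI impI) simp_all
qed

end
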